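(* Let $G$ be a group acting by coarse equivalences on a large scale space $X$. If the group $G$ is generated by a finite set $S$, then the collection of all families $\{\{x,gx\}\mid x\in X\}$, $g\in G$, is contained in the large scale structure generated by the single family $\mathcal{S}=\{S\cdot x\mid x\in X\}$, so that the identity set map $X\to X_G$ is a weak coarse quotient map with quotient scale $\mathcal{S}$.
   Context: For families of subsets of $X$, $\mathrm{st}(\mathcal{B},\mathcal{U})=\{\mathrm{st}(B,\mathcal{U})\mid B\in\mathcal{B}\}$, where $\mathrm{st}(B,\mathcal{U})$ is the union of the elements of $\mathcal{U}$ that intersect $B$. A large scale structure on a set $X$ is a nonempty set of families of subsets of $X$ (the uniformly bounded families) such that (1) if $\mathcal{B}_1$ is uniformly bounded and each element of $\mathcal{B}_2$ with more than one point is contained in some element of $\mathcal{B}_1$, then $\mathcal{B}_2$ is uniformly bounded; (2) $\mathrm{st}(\mathcal{B}_1,\mathcal{B}_2)$ is uniformly bounded whenever $\mathcal{B}_1,\mathcal{B}_2$ are. A large scale space is a set with a large scale structure. The large scale structure generated by a collection of families is the smallest one containing it. A map $f:X\to Y$ between large scale spaces is large scale continuous if $f(\mathcal{U})=\{f(U)\mid U\in\mathcal{U}\}$ is uniformly bounded for every uniformly bounded $\mathcal{U}$; a large scale continuous map is coarsely surjective if $Y\subseteq\mathrm{st}(f(X),\mathcal{V})$ for some uniformly bounded family $\mathcal{V}$ in $Y$. A large scale continuous map $f:X\to Y$ is a weak coarse quotient map if it is coarsely surjective and there is a uniformly bounded cover $\mathcal{V}$ of $Y$ such that the large scale structure of $Y$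 is generated by $f(\mathcal{X})\cup\{\mathcal{V}\}$, where $\mathcal{X}$ is the large scale structure of $X$ and $f(\mathcal{X})=\{f(\mathcal{U})\mid\mathcal{U}\in\mathcal{X}\}$; such a $\mathcal{V}$ is called a quotient scale of $f$. An action of $G$ on $X$ by coarse equivalences is an action on the underlying set such that every $g\in G$ acts as a large scale continuous map. $X_G$ is the set $X$ with the large scale structure generated by that of $X$ together with all families $\{\{x,gx\}\mid x\in X\}$, $g\in G$. For $S\subseteq G$ and $x\in X$, $S\cdot x=\{s\cdot x\mid s\in S\}$.
   Formalization: The finite generating set S is assumed to contain the identity of G; without this the claim fails, e.g. for the integers translating themselves (discrete structure) with S={1}, where all sets S·x are single points. *)

theory Defs
  imports "HOL-Algebra.Group_Action" "HOL-Algebra.Generated_Groups"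
begin

definition star :: "'a set \<Rightarrow> 'a set set \<Rightarrow> 'a set" where
  "star B \<U> = \<Union>{U \<in> \<U>. U \<inter> B \<noteq> {}}"

definition star_family :: "'a set set \<Rightarrow> 'a set set \<Rightarrow> 'a set set" where
  "star_family \<B> \<U> = {star B \<U> | B. B \<in> \<B>}"

definition large_scale_space :: "'a set \<Rightarrow> 'a set set set \<Rightarrow> bool" where
  "large_scale_space X L \<longleftrightarrow>
     L \<noteq> {} \<and>
     L \<subseteq> Pow (Pow X) \<and>
     (\<forall>\<B>1 \<B>2. \<B>1 \<in> L \<and> \<B>2 \<subseteq> Pow X \<and>
        (\<forall>B\<in>\<B>2. (\<exists>x\<in>B. \<exists>y\<in>B. x \<noteq> y) \<longrightarrow> (\<exists>A\<in>\<B>1. B \<subseteq> A)) \<longrightarrow> \<B>2 \<in> L) \<and>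
     (\<forall>\<B>1\<in>L. \<forall>\<B>2\<in>L. star_family \<B>1 \<B>2 \<in> L)"

definition ls_generated :: "'a set \<Rightarrow> 'a set set set \<Rightarrow> 'a set set set" where
  "ls_generated X C = \<Inter>{L. large_scale_space X L \<and> C \<subseteq> L}"

lemma large_scale_space_Pow: "large_scale_space X (Pow (Pow X))"
proof -
  have "star_family \<B>1 \<B>2 \<in> Pow (Pow X)" if "\<B>2 \<in> Pow (Pow X)" for \<B>1 \<B>2
    using that by (fastforce simp: star_family_def star_def)
  moreover have "Pow (Pow X) \<noteq> {}" by blast
  ultimately show ?thesis unfolding large_scale_space_def by simp
qed

text \<open>The next two lemmas show that \<open>ls_generated X C\<close> is the smallest large scale structure
  on \<open>X\<close> containing \<open>C\<close>, provided that \<open>C\<close> consists of families of subsets of \<open>X\<close>;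
  otherwise the intersection is over the empty set.\<close>

lemma large_scale_space_ls_generated:
  assumes "C \<subseteq> Pow (Pow X)"
  shows "large_scale_space X (ls_generated X C)" and "C \<subseteq> ls_generated X C"
proof -
  have empty_in: "{} \<in> L" if "large_scale_space X L" for L
  proof -
    from that obtain \<B> where "\<B> \<in> L" unfolding large_scale_space_def by (elim conjE) blast
    moreover have "\<forall>\<B>1 \<B>2. \<B>1 \<in> L \<and> \<B>2 \<subseteq> Pow X \<and>
        (\<forall>B\<in>\<B>2. (\<exists>x\<in>B. \<exists>y\<in>B. x \<noteq> y) \<longrightarrow> (\<exists>A\<in>\<B>1. B \<subseteq> A)) \<longrightarrow> \<B>2 \<in> L"
      using that unfolding large_scale_space_def by (elim conjE)
    ultimately show ?thesis by (elim allE[where x = \<B>] allE[where x = "{}"]) simp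
  qed
  have mem: "\<U> \<in> ls_generated X C \<longleftrightarrow> (\<forall>L. large_scale_space X L \<and> C \<subseteq> L \<longrightarrow> \<U> \<in> L)" for \<U>
    unfolding ls_generated_def by blast
  show "large_scale_space X (ls_generated X C)"
    unfolding large_scale_space_def[of X "ls_generated X C"]
  proof (intro conjI allI impI ballI)
    show "ls_generated X C \<noteq> {}" using mem empty_in by blast
    show "ls_generated X C \<subseteq> Pow (Pow X)"
      unfolding ls_generated_def using assms large_scale_space_Pow by (intro Inter_lower) simp
  next
    fix \<B>1 \<B>2
    assume *: "\<B>1 \<in> ls_generated X C \<and> \<B>2 \<subseteq> Pow X \<and>
      (\<forall>B\<in>\<B>2. (\<exists>x\<in>B. \<exists>y\<in>B. x \<noteq> y) \<longrightarrow> (\<exists>A\<in>\<B>1. B \<subseteq> A))"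
    show "\<B>2 \<in> ls_generated X C"
      unfolding mem
    proof (intro allI impI)
      fix L assume L: "large_scale_space X L \<and> C \<subseteq> L"
      then have "\<B>1 \<in> L" using * mem by simp
      moreover have "\<forall>\<B>1 \<B>2. \<B>1 \<in> L \<and> \<B>2 \<subseteq> Pow X \<and>
          (\<forall>B\<in>\<B>2. (\<exists>x\<in>B. \<exists>y\<in>B. x \<noteq> y) \<longrightarrow> (\<exists>A\<in>\<B>1. B \<subseteq> A)) \<longrightarrow> \<B>2 \<in> L"
        using L unfolding large_scale_space_def by (elim conjE)
      ultimately show "\<B>2 \<in> L" using * by (elim allE[where x = \<B>1] allE[where x = \<B>2]) simp
    qed
  next
    fix \<B>1 \<B>2 assume "\<B>1 \<in> ls_generated X C" "\<B>2 \<in> ls_generated X C"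
    moreover have "star_family \<B>1 \<B>2 \<in> L"
      if "large_scale_space X L" "\<B>1 \<in> L" "\<B>2 \<in> L" for L
      using that unfolding large_scale_space_def by (elim conjE) simp
    ultimately show "star_family \<B>1 \<B>2 \<in> ls_generated X C"
      unfolding mem by simp
  qed
  show "C \<subseteq> ls_generated X C"
    unfolding ls_generated_def by blast
qed

lemma ls_generated_least:
  assumes "large_scale_space X L" "C \<subseteq> L"
  shows "ls_generated X C \<subseteq> L"
  using assms unfolding ls_generated_def by blast

definition ls_continuous ::
    "'a set \<Rightarrow> 'a set set set \<Rightarrow> 'b set \<Rightarrow> 'b set set set \<Rightarrow> ('a \<Rightarrow> 'b) \<Rightarrow> bool" where
  "ls_continuous X LX Y LY f \<longleftrightarrow> f ` X \<subseteq> Y \<and> (\<forall>\<U>\<in>LX. (`) f ` \<U> \<in> LY)"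

definition coarsely_surjective ::
    "'a set \<Rightarrow> 'a set set set \<Rightarrow> 'b set \<Rightarrow> 'b set set set \<Rightarrow> ('a \<Rightarrow> 'b) \<Rightarrow> bool" where
  "coarsely_surjective X LX Y LY f \<longleftrightarrow>
     ls_continuous X LX Y LY f \<and> (\<exists>\<V>\<in>LY. Y \<subseteq> star (f ` X) \<V>)"

definition quotient_scale ::
    "'a set set set \<Rightarrow> 'b set \<Rightarrow> 'b set set set \<Rightarrow> ('a \<Rightarrow> 'b) \<Rightarrow> 'b set set \<Rightarrow> bool" where
  "quotient_scale LX Y LY f \<V> \<longleftrightarrow>
     \<V> \<in> LY \<and> \<Union>\<V> = Y \<and>
     LY = ls_generated Y ({(`) f ` \<U> | \<U>. \<U> \<in> LX} \<union> {\<V>})"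

definition weak_coarse_quotient_map ::
    "'a set \<Rightarrow> 'a set set set \<Rightarrow> 'b set \<Rightarrow> 'b set set set \<Rightarrow> ('a \<Rightarrow> 'b) \<Rightarrow> bool" where
  "weak_coarse_quotient_map X LX Y LY f \<longleftrightarrow>
     ls_continuous X LX Y LY f \<and> coarsely_surjective X LX Y LY f \<and>
     (\<exists>\<V>. quotient_scale LX Y LY f \<V>)"

definition acts_by_coarse_equivalences ::
    "('g, 'm) monoid_scheme \<Rightarrow> 'a set \<Rightarrow> 'a set set set \<Rightarrow> ('g \<Rightarrow> 'a \<Rightarrow> 'a) \<Rightarrow> bool" where
  "acts_by_coarse_equivalences G X L \<phi> \<longleftrightarrow>
     group_action G X \<phi> \<and> (\<forall>g\<in>carrier G. ls_continuous X L X L (\<phi> g))"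

definition translation_family :: "'a set \<Rightarrow> ('g \<Rightarrow> 'a \<Rightarrow> 'a) \<Rightarrow> 'g \<Rightarrow> 'a set set" where
  "translation_family X \<phi> g = {{x, \<phi> g x} | x. x \<in> X}"

definition translation_families ::
    "('g, 'm) monoid_scheme \<Rightarrow> 'a set \<Rightarrow> ('g \<Rightarrow> 'a \<Rightarrow> 'a) \<Rightarrow> 'a set set set" where
  "translation_families G X \<phi> = {translation_family X \<phi> g | g. g \<in> carrier G}"

text \<open>The large scale structure of \<open>X\<^sub>G\<close>; the underlying set is \<open>X\<close>.\<close>
definition action_structure ::
    "('g, 'm) monoid_scheme \<Rightarrow> 'a set \<Rightarrow> 'a set set set \<Rightarrow> ('g \<Rightarrow> 'a \<Rightarrow> 'a) \<Rightarrow> 'a set set set" where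
  "action_structure G X L \<phi> = ls_generated X (L \<union> translation_families G X \<phi>)"

text \<open>The set \<open>S \<cdot> x\<close> contains \<open>x\<close> in general only if \<open>\<one> \<in> S\<close>. For the translation action of
  the integers on themselves and \<open>S = {1}\<close> all members of \<open>orbit_family X \<phi> S\<close> are singletons,
  and for \<open>S = {1, -1}\<close> every member lies in a single parity class. In both cases the family
  generates a structure that does not contain \<open>translation_family X \<phi> 1\<close>. Results on
  generating sets \<open>S\<close> therefore need \<open>\<one> \<in> S\<close>.\<close>
definition orbit_family :: "'a set \<Rightarrow> ('g \<Rightarrow> 'a \<Rightarrow> 'a) \<Rightarrow> 'g set \<Rightarrow> 'a set set" where
  "orbit_family X \<phi> S = {{\<phi> s x | s. s \<in> S} | x. x \<in> X}"

end

(* A large scale structure L that contains the translation families of g and h contains that of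
   g h, since {x, g h x} lies in the star of {x, h x} with respect to the family of g. So the
   elements of G whose families lie in L form a subgroup. Since S contains the identity,
   {x, s x} is a subset of S x for s in S, so the structure generated by the orbit family has all
   translation families. Conversely S x arises, for finite S, by finitely many stars with respect
   to translation families, starting from {x}. *)
theory Submission
  imports Defs
begin

lemma large_scale_space_carrier:
  "large_scale_space X L \<Longrightarrow> L \<subseteq> Pow (Pow X)"
  unfolding large_scale_space_def by (elim conjE)

text \<open>Axiom (1) as a rule for the membership proofs below. The two distinct points become
  local assumptions, so a proof that covers every member of \<open>\<B>2\<close> can ignore
  them.\<close>

lemma large_scale_space_refine:
  assumes "large_scale_space X L" "\<B>1 \<in> L" "\<B>2 \<subseteq> Pow X"
    and "\<And>B x y. B \<in> \<B>2 \<Longrightarrow> x \<in> B \<Longrightarrow> y \<in> B \<Longrightarrow> x \<noteq> y \<Longrightarrow> \<exists>A\<in>\<B>1. B \<subseteq> A"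
  shows "\<B>2 \<in> L"
proof -
  have "\<forall>\<B>1 \<B>2. \<B>1 \<in> L \<and> \<B>2 \<subseteq> Pow X \<and>
      (\<forall>B\<in>\<B>2. (\<exists>x\<in>B. \<exists>y\<in>B. x \<noteq> y) \<longrightarrow> (\<exists>A\<in>\<B>1. B \<subseteq> A)) \<longrightarrow> \<B>2 \<in> L"
    using assms(1) unfolding large_scale_space_def by (elim conjE)
  moreover have "\<forall>B\<in>\<B>2. (\<exists>x\<in>B. \<exists>y\<in>B. x \<noteq> y) \<longrightarrow> (\<exists>A\<in>\<B>1. B \<subseteq> A)"
    using assms(4) by blast
  ultimately show ?thesis
    using assms(2,3) by (elim allE[where x = \<B>1] allE[where x = \<B>2]) simp
qed

lemma large_scale_space_star:
  assumes "large_scale_space X L" "\<B>1 \<in> L" "\<B>2 \<in> L"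
  shows "star_family \<B>1 \<B>2 \<in> L"
  using assms unfolding large_scale_space_def by (elim conjE) simp

text \<open>Axiom (1) constrains only members with two distinct points. Here there are none, so the
  family refines vacuously any element of \<open>L\<close>, which is nonempty.\<close>

lemma large_scale_space_trivial:
  assumes L: "large_scale_space X L" and B: "\<B> \<subseteq> Pow X"
    and trivial: "\<And>B x y. B \<in> \<B> \<Longrightarrow> x \<in> B \<Longrightarrow> y \<in> B \<Longrightarrow> x = y"
  shows "\<B> \<in> L"
proof -
  obtain \<A> where "\<A> \<in> L" using L unfolding large_scale_space_def by (elim conjE) blast
  then show ?thesis by (rule large_scale_space_refine[OF L _ B]) (use trivial in blast)
qed

context group_action
begin

lemma translation_family_subset:
  assumes "g \<in> carrier G"
  shows "translation_family E \<phi> g \<subseteq> Pow E"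
  using element_image[OF assms] unfolding translation_family_def by fastforce

lemma translation_families_subset: "translation_families G E \<phi> \<subseteq> Pow (Pow E)"
  using translation_family_subset unfolding translation_families_def by blast

lemma orbit_family_subset:
  assumes "S \<subseteq> carrier G"
  shows "orbit_family E \<phi> S \<subseteq> Pow E"
  using assms element_image unfolding orbit_family_def by fastforce

lemma one_acts_trivially: "x \<in> E \<Longrightarrow> \<phi> \<one>\<^bsub>G\<^esub> x = x"
  using fun_cong[OF id_eq_one, of x] by simp

lemma orbit_family_refl:
  assumes "\<one>\<^bsub>G\<^esub> \<in> S" "x \<in> E"
  shows "x \<in> {\<phi> s x | s. s \<in> S}"
  using assms(1) one_acts_trivially[OF assms(2)] by force

text \<open>A quotient scale has to cover the space; each x lies in its own set S x because the
  identity is in \<open>S\<close>.\<close>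

lemma Union_orbit_family:
  assumes "S \<subseteq> carrier G" "\<one>\<^bsub>G\<^esub> \<in> S"
  shows "\<Union>(orbit_family E \<phi> S) = E"
proof
  show "\<Union>(orbit_family E \<phi> S) \<subseteq> E" using orbit_family_subset[OF assms(1)] by blast
  show "E \<subseteq> \<Union>(orbit_family E \<phi> S)"
    using orbit_family_refl[OF assms(2)] unfolding orbit_family_def by blast
qed

text \<open>The pairs are unordered: with y = inv g x, the pair {x, inv g x} is {y, g y}.\<close>

lemma translation_family_inv:
  assumes "g \<in> carrier G"
  shows "translation_family E \<phi> (inv\<^bsub>G\<^esub> g) = translation_family E \<phi> g"
proof -
  interpret group G using group_hom group_hom.axioms(1) by blast
  \<comment> \<open>One inclusion for all h suffices: h = g and h = inv g give the two directions,
    since inv (inv g) = g.\<close>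
  have "translation_family E \<phi> (inv\<^bsub>G\<^esub> h) \<subseteq> translation_family E \<phi> h"
    if h: "h \<in> carrier G" for h
  proof
    fix A assume "A \<in> translation_family E \<phi> (inv\<^bsub>G\<^esub> h)"
    then obtain x where x: "x \<in> E" and A: "A = {x, \<phi> (inv\<^bsub>G\<^esub> h) x}"
      unfolding translation_family_def by blast
    have y: "\<phi> (inv\<^bsub>G\<^esub> h) x \<in> E"
      using element_image[OF inv_closed[OF h] x] by simp
    have "\<phi> h (\<phi> (inv\<^bsub>G\<^esub> h) x) = x"
      using orbit_sym_aux[OF inv_closed[OF h] x refl] h by simp
    then have "A = {\<phi> (inv\<^bsub>G\<^esub> h) x, \<phi> h (\<phi> (inv\<^bsub>G\<^esub> h) x)}" using A by auto
    then show "A \<in> translation_family E \<phi> h" using y unfolding translation_family_def by blast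
  qed
  from this[OF assms] this[OF inv_closed[OF assms]] show ?thesis using assms by simp
qed

lemma translation_family_mult:
  assumes L: "large_scale_space E L" and g: "g \<in> carrier G" and h: "h \<in> carrier G"
    and gL: "translation_family E \<phi> g \<in> L" and hL: "translation_family E \<phi> h \<in> L"
  shows "translation_family E \<phi> (g \<otimes>\<^bsub>G\<^esub> h) \<in> L"
proof (rule large_scale_space_refine[OF L large_scale_space_star[OF L hL gL]])
  interpret group G using group_hom group_hom.axioms(1) by blast
  show "translation_family E \<phi> (g \<otimes>\<^bsub>G\<^esub> h) \<subseteq> Pow E"
    using translation_family_subset g h by simp
  fix A assume "A \<in> translation_family E \<phi> (g \<otimes>\<^bsub>G\<^esub> h)"
  then obtain x where x: "x \<in> E" and A: "A = {x, \<phi> (g \<otimes>\<^bsub>G\<^esub> h) x}"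
    unfolding translation_family_def by blast
  let ?B = "star {x, \<phi> h x} (translation_family E \<phi> g)"
  have hx: "\<phi> h x \<in> E" using element_image[OF h x] by simp
  \<comment> \<open>Both pairs meet {x, h x}, the first in x and the second in h x, so the star
    contains x and g (h x).\<close>
  have "{x, \<phi> g x} \<in> translation_family E \<phi> g" "{\<phi> h x, \<phi> g (\<phi> h x)} \<in> translation_family E \<phi> g"
    unfolding translation_family_def using x hx by blast+
  then have "{x, \<phi> g (\<phi> h x)} \<subseteq> ?B" unfolding star_def by blast
  then have "A \<subseteq> ?B" using A composition_rule[OF x g h] by simp
  moreover have "?B \<in> star_family (translation_family E \<phi> h) (translation_family E \<phi> g)"
    unfolding star_family_def translation_family_def[of E \<phi> h] using x by blast
  ultimately show
    "\<exists>B\<in>star_family (translation_family E \<phi> h) (translation_family E \<phi> g). A \<subseteq> B" by blast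
qed

lemma translation_families_generate:
  assumes L: "large_scale_space E L" and S: "S \<subseteq> carrier G"
    and SL: "\<And>s. s \<in> S \<Longrightarrow> translation_family E \<phi> s \<in> L"
    and g: "g \<in> generate G S"
  shows "translation_family E \<phi> g \<in> L"
proof -
  interpret group G using group_hom group_hom.axioms(1) by blast
  show ?thesis
    using g
  proof (induction rule: generate.induct)
    case one
    \<comment> \<open>The members {x, 1 x} are singletons.\<close>
    show ?case
      by (rule large_scale_space_trivial[OF L translation_family_subset[OF one_closed]])
        (auto simp: translation_family_def one_acts_trivially)
  next
    case (incl h)
    then show ?case by (rule SL)
  next
    case (inv h)
    \<comment> \<open>\<open>generate\<close> introduces inverses of elements of \<open>S\<close>
      only, and inversion leaves the translation family unchanged.\<close>
    then show ?case using translation_family_inv[OF subsetD[OF S]] SL by simp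
  next
    case (eng h1 h2)
    then show ?case using translation_family_mult[OF L] generate_in_carrier[OF S] by blast
  qed
qed

lemma translation_family_in_orbit_structure:
  assumes L: "large_scale_space E L" and S: "S \<subseteq> carrier G" "\<one>\<^bsub>G\<^esub> \<in> S"
    and SL: "orbit_family E \<phi> S \<in> L" and s: "s \<in> S"
  shows "translation_family E \<phi> s \<in> L"
proof (rule large_scale_space_refine[OF L SL])
  show "translation_family E \<phi> s \<subseteq> Pow E" using translation_family_subset S s by blast
  fix A assume "A \<in> translation_family E \<phi> s"
  then obtain x where x: "x \<in> E" and A: "A = {x, \<phi> s x}"
    unfolding translation_family_def by blast
  have "A \<subseteq> {\<phi> s x | s. s \<in> S}" using A s orbit_family_refl[OF S(2) x] by blast
  then show "\<exists>B\<in>orbit_family E \<phi> S. A \<subseteq> B" unfolding orbit_family_def using x by blast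
qed

text \<open>\<open>L\<close> is arbitrary here because the result is needed for two structures: the
  one generated by the orbit family alone, and the one generated by it together with the structure
  of X.\<close>

lemma translation_families_subset_orbit_structure:
  assumes L: "large_scale_space E L" and S: "S \<subseteq> carrier G" "\<one>\<^bsub>G\<^esub> \<in> S"
    and gen: "generate G S = carrier G" and SL: "orbit_family E \<phi> S \<in> L"
  shows "translation_families G E \<phi> \<subseteq> L"
  using translation_families_generate[OF L S(1) translation_family_in_orbit_structure[OF L S SL]]
    gen unfolding translation_families_def by blast

text \<open>Induction on \<open>S\<close>, one star per element. Inserting the identity, rather than
  assuming it in \<open>S\<close>, lets the induction start at the empty set, where the members are
  singletons.\<close>

lemma orbit_family_in_structure:
  assumes L: "large_scale_space E L" and "finite S" "S \<subseteq> carrier G"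
    and "\<And>s. s \<in> S \<Longrightarrow> translation_family E \<phi> s \<in> L"
  shows "orbit_family E \<phi> (insert \<one>\<^bsub>G\<^esub> S) \<in> L"
  using assms(2-)
proof (induction S rule: finite_induct)
  case empty
  interpret group G using group_hom group_hom.axioms(1) by blast
  show ?case
    by (rule large_scale_space_trivial[OF L orbit_family_subset]) (auto simp: orbit_family_def)
next
  case (insert g S)
  interpret group G using group_hom group_hom.axioms(1) by blast
  have g: "g \<in> carrier G" and gL: "translation_family E \<phi> g \<in> L" using insert.prems by auto
  have SL: "orbit_family E \<phi> (insert \<one>\<^bsub>G\<^esub> S) \<in> L" using insert by blast
  show ?case
  proof (rule large_scale_space_refine[OF L large_scale_space_star[OF L SL gL]])
    show "orbit_family E \<phi> (insert \<one>\<^bsub>G\<^esub> (insert g S)) \<subseteq> Pow E"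
      using insert.prems by (intro orbit_family_subset) auto
    fix A assume "A \<in> orbit_family E \<phi> (insert \<one>\<^bsub>G\<^esub> (insert g S))"
    then obtain x where x: "x \<in> E" and A: "A = {\<phi> s x | s. s \<in> insert \<one>\<^bsub>G\<^esub> (insert g S)}"
      unfolding orbit_family_def by blast
    let ?O = "{\<phi> s x | s. s \<in> insert \<one>\<^bsub>G\<^esub> S}"
    let ?B = "star ?O (translation_family E \<phi> g)"
    have O: "?O \<in> orbit_family E \<phi> (insert \<one>\<^bsub>G\<^esub> S)" unfolding orbit_family_def using x by blast
    then have "?O \<subseteq> E" using orbit_family_subset[of "insert \<one>\<^bsub>G\<^esub> S"] insert.prems by auto
    \<comment> \<open>The pair {y, g y} meets \<open>?O\<close> in y, so it is part of the
      star.\<close>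
    then have step: "y \<in> ?B \<and> \<phi> g y \<in> ?B" if "y \<in> ?O" for y
      using that unfolding star_def translation_family_def by blast
    \<comment> \<open>The identity puts x into \<open>?O\<close>, so the star reaches g x, the only
      point that \<open>A\<close> may have beyond \<open>?O\<close>.\<close>
    have "\<phi> g x \<in> ?B" using step[OF orbit_family_refl[OF insertI1 x]] by blast
    then have "A \<subseteq> ?B" using A step by blast
    moreover have
      "?B \<in> star_family (orbit_family E \<phi> (insert \<one>\<^bsub>G\<^esub> S)) (translation_family E \<phi> g)"
      unfolding star_family_def using O by blast
    ultimately show
      "\<exists>B\<in>star_family (orbit_family E \<phi> (insert \<one>\<^bsub>G\<^esub> S)) (translation_family E \<phi> g). A \<subseteq> B"
      by blast
  qed
qed

end

theorem mainTheorem6: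
  fixes G :: "('g, 'm) monoid_scheme" and X :: "'a set" and L :: "'a set set set"
    and \<phi> :: "'g \<Rightarrow> 'a \<Rightarrow> 'a" and S :: "'g set"
  assumes "group G"
    and "large_scale_space X L"
    and "acts_by_coarse_equivalences G X L \<phi>"
    and "finite S" and "S \<subseteq> carrier G" and "generate G S = carrier G"
    and "\<one>\<^bsub>G\<^esub> \<in> S"
  shows "translation_families G X \<phi> \<subseteq> ls_generated X {orbit_family X \<phi> S} \<and>
    weak_coarse_quotient_map X L X (action_structure G X L \<phi>) (\<lambda>x. x) \<and>
    quotient_scale L X (action_structure G X L \<phi>) (\<lambda>x. x) (orbit_family X \<phi> S)"
proof -
  interpret group_action G X \<phi>
    using assms(3) unfolding acts_by_coarse_equivalences_def by simp
  let ?O = "orbit_family X \<phi> S"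
  let ?A = "action_structure G X L \<phi>"
  note trans = translation_families_subset_orbit_structure[OF _ assms(5,7,6)]
  have O: "{?O} \<subseteq> Pow (Pow X)" using orbit_family_subset[OF assms(5)] by simp
  have part1: "translation_families G X \<phi> \<subseteq> ls_generated X {?O}"
    using trans large_scale_space_ls_generated[OF O] by simp
  have LT: "L \<union> translation_families G X \<phi> \<subseteq> Pow (Pow X)"
    using large_scale_space_carrier[OF assms(2)] translation_families_subset by simp
  have LO: "L \<union> {?O} \<subseteq> Pow (Pow X)"
    using large_scale_space_carrier[OF assms(2)] O by simp
  have A: "large_scale_space X ?A" and LA: "L \<subseteq> ?A" and TA: "translation_families G X \<phi> \<subseteq> ?A"
    using large_scale_space_ls_generated[OF LT] unfolding action_structure_def by auto
  have "translation_family X \<phi> s \<in> ?A" if "s \<in> S" for s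
    using that TA assms(5) unfolding translation_families_def by blast
  then have OA: "?O \<in> ?A"
    using orbit_family_in_structure[OF A assms(4,5)] assms(7) by (simp add: insert_absorb)
  \<comment> \<open>Images under the identity map return \<open>L\<close>, so this is the generation
    condition of \<open>quotient_scale\<close>. Each generating collection lies in the structure
    generated by the other.\<close>
  have eq: "?A = ls_generated X (L \<union> {?O})"
  proof
    show "?A \<subseteq> ls_generated X (L \<union> {?O})"
      unfolding action_structure_def
      using large_scale_space_ls_generated[OF LO] trans by (intro ls_generated_least) auto
    show "ls_generated X (L \<union> {?O}) \<subseteq> ?A"
      using A LA OA by (intro ls_generated_least) auto
  qed
  have U: "\<Union>?O = X" by (rule Union_orbit_family[OF assms(5,7)])
  have scale: "quotient_scale L X ?A (\<lambda>x. x) ?O"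
    unfolding quotient_scale_def using OA U eq by simp
  have cont: "ls_continuous X L X ?A (\<lambda>x. x)"
    unfolding ls_continuous_def using LA by auto
  \<comment> \<open>The image is all of X, so every nonempty member of the cover \<open>?O\<close>
    meets it.\<close>
  have "X \<subseteq> star ((\<lambda>x. x) ` X) ?O" using U unfolding star_def by auto
  then have "coarsely_surjective X L X ?A (\<lambda>x. x)"
    unfolding coarsely_surjective_def using cont OA by blast
  then show ?thesis
    using part1 scale cont unfolding weak_coarse_quotient_map_def by blast
qed

end
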